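(* Let $c$ be a positive integer and let $a,b\in\{1,\ldots,c-1\}$ with $\gcd(a,b,c)=1$. Let $M$ be the set of $(x,y)\in\mathbb{N}^2$ such that $ax+by\equiv 0\pmod c$. Then $$\mathrm{inCl}(M)\cong\mathrm{Cl}(M)\cong\mathbb{Z}_{\frac{c}{\gcd(a,c)\gcd(b,c)}}.$$
   Context: $\mathbb{N}=\{0,1,2,\dots\}$ and $\mathbb{Z}_n=\mathbb{Z}/n\mathbb{Z}$. $M$ is a monoid under addition, with tame Cale base $Q=\{q_1,q_2\}$, where $q_1=\left(\frac{c}{\gcd(a,c)},0\right)$ and $q_2=\left(0,\frac{c}{\gcd(b,c)}\right)$. The class groups are defined as follows. For $x,y\in M$ write $x\le_M y$ if $x+z=y$ for some $z\in M$, and let $\lambda(x,y)=\sup\{m/n\mid m\in\mathbb{N},\ n\in\mathbb{Z}^+,\ mx\le_M ny\}$. For $q\in Q$ let $\ell(q)$ be the least positive integer such that $\ell(q)\lambda(q,x)\in\mathbb{N}$ for all $x\in M$. Define $\varphi:M\to\mathbb{N}^{Q}$ by $\varphi(x)(q)=\ell(q)\lambda(q,x)$; this is an injective monoid morphism. For a cancellative commutative monoid $S$ and a submonoid $T$ of $S$, with $\mathrm{G}(T)$ the subgroup generated by $T$ in the quotient group of $S$, $S/T$ denotes the quotient of $S$ by the congruence $s\sim_T s'$ iff $s'-s\in\mathrm{G}(T)$. The (outer) class group is $\mathrm{Cl}(M)=\mathbb{N}^{Q}/\varphi(M)$ and the inner class group is $\mathrm{inCl}(M)=\varphi(M)/\varphi(F)$,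 where $F=\langle Q\rangle$ is the submonoid of $M$ generated by $Q$. *)

theory Defs
  imports "HOL-Algebra.Algebra" "HOL-Number_Theory.Cong"
    "HOL-Library.Extended_Nonnegative_Real"
begin

text \<open>
  Commutative monoids are rendered as HOL-Algebra records, hence multiplicatively:
  \<open>x \<otimes> y\<close> is the sum of \<open>x\<close> and \<open>y\<close>, \<open>x [^] m\<close> is \<open>m x\<close>, and \<open>divides\<close> is the
  relation \<open>x + z = y for some z\<close>.
\<close>

definition nat_monoid :: "nat monoid"
  where "nat_monoid = \<lparr>carrier = UNIV, monoid.mult = (+), one = 0\<rparr>"


subsection \<open>Quotient groups and quotients by submonoids\<close>

text \<open>
  In the quotient group of a cancellative commutative monoid the pair \<open>(x, y)\<close>
  stands for the difference \<open>x - y\<close>.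
\<close>

definition diff_rel :: "('a, 'b) monoid_scheme \<Rightarrow> (('a \<times> 'a) \<times> ('a \<times> 'a)) set"
  where "diff_rel S = {((x, y), (x', y')).
    x \<in> carrier S \<and> y \<in> carrier S \<and> x' \<in> carrier S \<and> y' \<in> carrier S \<and>
    x \<otimes>\<^bsub>S\<^esub> y' = x' \<otimes>\<^bsub>S\<^esub> y}"

definition quotient_group :: "('a, 'b) monoid_scheme \<Rightarrow> ('a \<times> 'a) set monoid"
  where "quotient_group S =
    \<lparr>carrier = (carrier S \<times> carrier S) // diff_rel S,
     monoid.mult = (\<lambda>A B. \<Union>(x, y)\<in>A. \<Union>(x', y')\<in>B. diff_rel S `` {(x \<otimes>\<^bsub>S\<^esub> x', y \<otimes>\<^bsub>S\<^esub> y')}),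
     one = diff_rel S `` {(\<one>\<^bsub>S\<^esub>, \<one>\<^bsub>S\<^esub>)}\<rparr>"

definition embed :: "('a, 'b) monoid_scheme \<Rightarrow> 'a \<Rightarrow> ('a \<times> 'a) set"
  where "embed S x = diff_rel S `` {(x, \<one>\<^bsub>S\<^esub>)}"

definition submonoid_cong :: "('a, 'b) monoid_scheme \<Rightarrow> 'a set \<Rightarrow> ('a \<times> 'a) set"
  where "submonoid_cong S T = {(s, s'). s \<in> carrier S \<and> s' \<in> carrier S \<and>
    embed S s' \<otimes>\<^bsub>quotient_group S\<^esub> inv\<^bsub>quotient_group S\<^esub> (embed S s)
      \<in> generate (quotient_group S) (embed S ` T)}"

definition monoid_quotient :: "('a, 'b) monoid_scheme \<Rightarrow> 'a set \<Rightarrow> 'a set monoid"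
  where "monoid_quotient S T =
    \<lparr>carrier = carrier S // submonoid_cong S T,
     monoid.mult = (\<lambda>A B. \<Union>s\<in>A. \<Union>s'\<in>B. submonoid_cong S T `` {s \<otimes>\<^bsub>S\<^esub> s'}),
     one = submonoid_cong S T `` {\<one>\<^bsub>S\<^esub>}\<rparr>"


subsection \<open>Class groups with respect to a base\<close>

text \<open>The supremum is taken in \<open>[0, \<infinity>]\<close>, as the set need not be bounded (take \<open>x\<close> neutral).\<close>

definition lam :: "('a, 'b) monoid_scheme \<Rightarrow> 'a \<Rightarrow> 'a \<Rightarrow> ennreal"
  where "lam M x y = Sup {ennreal (real m / real n) | m n :: nat.
    n > 0 \<and> (x [^]\<^bsub>M\<^esub> m) divides\<^bsub>M\<^esub> (y [^]\<^bsub>M\<^esub> n)}"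

definition ell :: "('a, 'b) monoid_scheme \<Rightarrow> 'a \<Rightarrow> nat"
  where "ell M q = (LEAST l. l > 0 \<and> (\<forall>x\<in>carrier M. of_nat l * lam M q x \<in> \<nat>))"

definition phi :: "('a, 'b) monoid_scheme \<Rightarrow> 'a set \<Rightarrow> 'a \<Rightarrow> 'a \<Rightarrow> nat"
  where "phi M Q x = (\<lambda>q\<in>Q. THE k. of_nat k = of_nat (ell M q) * lam M q x)"

text \<open>The monoid of all functions from \<open>Q\<close> to the natural numbers.\<close>

definition free_monoid :: "'a set \<Rightarrow> ('a \<Rightarrow> nat) monoid"
  where "free_monoid Q = product_group Q (\<lambda>_. nat_monoid)"

definition outer_class_group :: "('a, 'b) monoid_scheme \<Rightarrow> 'a set \<Rightarrow> ('a \<Rightarrow> nat) set monoid"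
  where "outer_class_group M Q = monoid_quotient (free_monoid Q) (phi M Q ` carrier M)"

definition inner_class_group :: "('a, 'b) monoid_scheme \<Rightarrow> 'a set \<Rightarrow> ('a \<Rightarrow> nat) set monoid"
  where "inner_class_group M Q =
    monoid_quotient (free_monoid Q\<lparr>carrier := phi M Q ` carrier M\<rparr>)
      (phi M Q ` ((\<lambda>H. submonoid H M) hull Q))"


subsection \<open>The monoid of solutions of a linear congruence\<close>

definition cong_monoid :: "nat \<Rightarrow> nat \<Rightarrow> nat \<Rightarrow> (nat \<times> nat) monoid"
  where "cong_monoid a b c =
    (nat_monoid \<times>\<times> nat_monoid)\<lparr>carrier := {(x, y). [a * x + b * y = 0] (mod c)}\<rparr>"

definition cong_base :: "nat \<Rightarrow> nat \<Rightarrow> nat \<Rightarrow> (nat \<times> nat) set"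
  where "cong_base a b c = {(c div gcd a c, 0), (0, c div gcd b c)}"

end

theory Submission
  imports Defs
begin

text \<open>
Write \<open>g = gcd(a, c)\<close>, \<open>h = gcd(b, c)\<close>; these are coprime because \<open>gcd(a, b, c) = 1\<close>, so
\<open>a = g\<alpha>\<close>, \<open>b = h\<beta>\<close>, \<open>c = ghn\<close> with \<open>\<alpha>\<close> and \<open>\<beta>\<close> invertible modulo \<open>n\<close>. A pair is in \<open>M\<close> iff it has the
form \<open>(hu, gv)\<close> with \<open>\<alpha>u + \<beta>v \<equiv> 0 (mod n)\<close> (\<open>in_M_iff\<close>), and \<open>q\<^sub>1 = (hn, 0)\<close>, \<open>q\<^sub>2 = (0, gn)\<close>.

Divisibility in \<open>M\<close> is the componentwise order, so \<open>\<lambda>(q\<^sub>1, (hu, gv)) = u / n\<close> and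
\<open>\<lambda>(q\<^sub>2, (hu, gv)) = v / n\<close>. Solutions with \<open>u = 1\<close> and solutions with \<open>v = 1\<close> exist, whence
\<open>\<ell>(q\<^sub>1) = \<ell>(q\<^sub>2) = n\<close> and \<open>\<phi>(hu, gv) = (u, v)\<close> (\<open>phi_scaled\<close>). Therefore \<open>\<phi>(M)\<close> is the set of
\<open>(u, v)\<close> in \<open>\<nat>\<^sup>2\<close> with \<open>\<alpha>u + \<beta>v \<equiv> 0 (mod n)\<close>, and \<open>\<phi>(F) = n\<nat> \<times> n\<nat>\<close>.

Each class group is thus the quotient of a monoid by the kernel of a surjection onto \<open>\<int>/n\<int>\<close>:
\<open>\<phi>(M)\<close> is the kernel of \<open>(u, v) \<mapsto> \<alpha>u + \<beta>v\<close> on \<open>\<nat>\<^sup>2\<close>, and \<open>\<phi>(F)\<close> is the kernel of \<open>(u, v) \<mapsto> u\<close> on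
\<open>\<phi>(M)\<close>. That such a quotient is isomorphic to the target is \<open>monoid_quotient_kernel_iso\<close>; it holds for any
morphism of a cancellative commutative monoid onto a group of finite exponent.
\<close>

section \<open>Quotients of cancellative commutative monoids\<close>

context comm_monoid_cancel
begin

lemma equiv_diff_rel: "equiv (carrier G \<times> carrier G) (diff_rel G)"
proof (rule equivI)
  show "diff_rel G \<subseteq> (carrier G \<times> carrier G) \<times> carrier G \<times> carrier G"
    by (auto simp: diff_rel_def)
  show "refl_on (carrier G \<times> carrier G) (diff_rel G)"
    by (auto simp: refl_on_def diff_rel_def)
  show "sym (diff_rel G)"
    by (auto simp: sym_def diff_rel_def)
  show "trans (diff_rel G)"
  proof (rule transI)
    fix p q r assume "(p, q) \<in> diff_rel G" "(q, r) \<in> diff_rel G"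
    then obtain x y x' y' x'' y'' where pqr: "p = (x, y)" "q = (x', y')" "r = (x'', y'')"
      and [simp]: "x \<in> carrier G" "y \<in> carrier G" "x' \<in> carrier G" "y' \<in> carrier G"
        "x'' \<in> carrier G" "y'' \<in> carrier G"
      and 1: "x \<otimes> y' = x' \<otimes> y" and 2: "x' \<otimes> y'' = x'' \<otimes> y'"
      by (cases p, cases q, cases r) (auto simp: diff_rel_def)
    have "(x \<otimes> y'') \<otimes> y' = (x \<otimes> y') \<otimes> y''"
      by (simp add: m_ac)
    also have "\<dots> = (x' \<otimes> y'') \<otimes> y"
      by (simp add: 1 m_ac)
    also have "\<dots> = (x'' \<otimes> y) \<otimes> y'"
      by (simp add: 2 m_ac)
    finally have "x \<otimes> y'' = x'' \<otimes> y"
      by (rule r_cancel) auto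
    then show "(p, r) \<in> diff_rel G"
      by (simp add: pqr diff_rel_def)
  qed
qed

definition difference :: "'a \<Rightarrow> 'a \<Rightarrow> ('a \<times> 'a) set"
  where "difference x y = diff_rel G `` {(x, y)}"

lemma difference_eq_iff:
  assumes "x \<in> carrier G" "y \<in> carrier G" "x' \<in> carrier G" "y' \<in> carrier G"
  shows "difference x y = difference x' y' \<longleftrightarrow> x \<otimes> y' = x' \<otimes> y"
  unfolding difference_def
  using assms by (subst eq_equiv_class_iff[OF equiv_diff_rel]) (auto simp: diff_rel_def)

lemma carrier_quotient_group:
  "carrier (quotient_group G) = {difference x y | x y. x \<in> carrier G \<and> y \<in> carrier G}"
  by (auto simp: quotient_group_def quotient_def difference_def)

lemma difference_in_carrier [simp]:
  "x \<in> carrier G \<Longrightarrow> y \<in> carrier G \<Longrightarrow> difference x y \<in> carrier (quotient_group G)"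
  by (auto simp: carrier_quotient_group)

lemma one_quotient_group: "\<one>\<^bsub>quotient_group G\<^esub> = difference \<one> \<one>"
  by (simp add: quotient_group_def difference_def)

lemma embed_eq_difference: "embed G x = difference x \<one>"
  by (simp add: embed_def difference_def)

lemma mult_quotient_group:
  assumes [simp]: "x \<in> carrier G" "y \<in> carrier G" "x' \<in> carrier G" "y' \<in> carrier G"
  shows "difference x y \<otimes>\<^bsub>quotient_group G\<^esub> difference x' y' = difference (x \<otimes> x') (y \<otimes> y')"
proof -
  have *: "difference (u \<otimes> u') (v \<otimes> v') = difference (x \<otimes> x') (y \<otimes> y')"
    if "(u, v) \<in> difference x y" "(u', v') \<in> difference x' y'" for u v u' v'
  proof -
    have [simp]: "u \<in> carrier G" "v \<in> carrier G" "u' \<in> carrier G" "v' \<in> carrier G"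
      and 1: "x \<otimes> v = u \<otimes> y" "x' \<otimes> v' = u' \<otimes> y'"
      using that by (auto simp: difference_def diff_rel_def)
    have "(u \<otimes> u') \<otimes> (y \<otimes> y') = (u \<otimes> y) \<otimes> (u' \<otimes> y')"
      by (simp add: m_ac)
    also have "\<dots> = (x \<otimes> x') \<otimes> (v \<otimes> v')"
      by (simp add: m_ac flip: 1)
    finally show ?thesis
      by (simp add: difference_eq_iff)
  qed
  have "difference x y \<otimes>\<^bsub>quotient_group G\<^esub> difference x' y' =
      (\<Union>(u, v)\<in>difference x y. \<Union>(u', v')\<in>difference x' y'. difference (u \<otimes> u') (v \<otimes> v'))"
    by (simp add: quotient_group_def difference_def)
  also have "\<dots> = (\<Union>p\<in>difference x y. \<Union>p'\<in>difference x' y'. difference (x \<otimes> x') (y \<otimes> y'))"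
    by (simp add: split_beta * cong: SUP_cong)
  also have "\<dots> = difference (x \<otimes> x') (y \<otimes> y')"
  proof -
    have "(x, y) \<in> difference x y" "(x', y') \<in> difference x' y'"
      by (auto simp: difference_def diff_rel_def)
    then show ?thesis
      by blast
  qed
  finally show ?thesis .
qed

lemma group_quotient_group: "group (quotient_group G)"
proof (rule groupI)
  fix p assume "p \<in> carrier (quotient_group G)"
  then obtain x y where "p = difference x y" "x \<in> carrier G" "y \<in> carrier G"
    by (auto simp: carrier_quotient_group)
  then show "\<one>\<^bsub>quotient_group G\<^esub> \<otimes>\<^bsub>quotient_group G\<^esub> p = p"
    by (simp add: one_quotient_group mult_quotient_group)
  show "\<exists>q\<in>carrier (quotient_group G). q \<otimes>\<^bsub>quotient_group G\<^esub> p = \<one>\<^bsub>quotient_group G\<^esub>"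
    using \<open>p = _\<close> \<open>x \<in> _\<close> \<open>y \<in> _\<close>
    by (intro bexI[of _ "difference y x"])
      (simp_all add: one_quotient_group mult_quotient_group difference_eq_iff m_comm)
next
  fix p q r assume "p \<in> carrier (quotient_group G)" "q \<in> carrier (quotient_group G)"
    "r \<in> carrier (quotient_group G)"
  then show "p \<otimes>\<^bsub>quotient_group G\<^esub> q \<otimes>\<^bsub>quotient_group G\<^esub> r =
      p \<otimes>\<^bsub>quotient_group G\<^esub> (q \<otimes>\<^bsub>quotient_group G\<^esub> r)"
    by (auto simp: carrier_quotient_group mult_quotient_group m_assoc)
next
  fix p q assume "p \<in> carrier (quotient_group G)" "q \<in> carrier (quotient_group G)"
  then obtain x y x' y' where "p = difference x y" "q = difference x' y'"
    "x \<in> carrier G" "y \<in> carrier G" "x' \<in> carrier G" "y' \<in> carrier G"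
    by (auto simp: carrier_quotient_group)
  then show "p \<otimes>\<^bsub>quotient_group G\<^esub> q \<in> carrier (quotient_group G)"
    by (simp add: mult_quotient_group)
qed (simp add: one_quotient_group)

lemma inv_quotient_group:
  assumes "x \<in> carrier G" "y \<in> carrier G"
  shows "inv\<^bsub>quotient_group G\<^esub> (difference x y) = difference y x"
  using assms
  by (intro group.inv_equality[OF group_quotient_group])
    (auto simp: one_quotient_group mult_quotient_group difference_eq_iff m_comm)

text \<open>
By commutativity a product of elements of \<open>T\<close> and their inverses can be sorted into one element
of \<open>T\<close> and one inverse.
\<close>

lemma generate_embed_submonoid:
  assumes "submonoid T G"
  shows "generate (quotient_group G) (embed G ` T) = {difference t t' | t t'. t \<in> T \<and> t' \<in> T}"
    (is "_ = ?D")
proof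
  interpret T: submonoid T G by fact
  have [simp]: "t \<in> carrier G" if "t \<in> T" for t
    using that T.subset by blast
  show "generate (quotient_group G) (embed G ` T) \<subseteq> ?D"
  proof
    fix p assume "p \<in> generate (quotient_group G) (embed G ` T)"
    then show "p \<in> ?D"
    proof induction
      case (eng p q)
      then obtain s s' t t' where "p = difference s s'" "q = difference t t'"
        "s \<in> T" "s' \<in> T" "t \<in> T" "t' \<in> T"
        by blast
      then have "p \<otimes>\<^bsub>quotient_group G\<^esub> q = difference (s \<otimes> t) (s' \<otimes> t')"
        "s \<otimes> t \<in> T" "s' \<otimes> t' \<in> T"
        by (simp_all add: mult_quotient_group)
      then show ?case
        by blast
    qed (use T.one_closed in \<open>force simp: one_quotient_group embed_eq_difference inv_quotient_group\<close>)+
  qed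
  show "?D \<subseteq> generate (quotient_group G) (embed G ` T)"
  proof clarify
    fix t t' assume [simp]: "t \<in> T" "t' \<in> T"
    have "embed G t \<otimes>\<^bsub>quotient_group G\<^esub> inv\<^bsub>quotient_group G\<^esub> embed G t'
      \<in> generate (quotient_group G) (embed G ` T)"
      by (intro generate.eng generate.incl generate.inv) auto
    then show "difference t t' \<in> generate (quotient_group G) (embed G ` T)"
      by (simp add: embed_eq_difference inv_quotient_group mult_quotient_group)
  qed
qed

text \<open>
Equality of formal differences is an equation in the monoid itself, so the congruence can be
tested without mentioning the quotient group. From here on the quotient group does not occur.
\<close>

lemma submonoid_cong_iff:
  assumes "submonoid T G"
  shows "(s, s') \<in> submonoid_cong G T \<longleftrightarrow>
    s \<in> carrier G \<and> s' \<in> carrier G \<and> (\<exists>t\<in>T. \<exists>t'\<in>T. s' \<otimes> t' = s \<otimes> t)"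
proof (cases "s \<in> carrier G \<and> s' \<in> carrier G")
  case True
  have [simp]: "t \<in> carrier G" if "t \<in> T" for t
    using that submonoid.subset[OF assms] by blast
  have "embed G s' \<otimes>\<^bsub>quotient_group G\<^esub> inv\<^bsub>quotient_group G\<^esub> embed G s = difference s' s"
    using True by (simp add: embed_eq_difference inv_quotient_group mult_quotient_group)
  moreover have "difference s' s = difference t t' \<longleftrightarrow> s' \<otimes> t' = s \<otimes> t" if "t \<in> T" "t' \<in> T" for t t'
    using that True by (simp add: difference_eq_iff m_comm)
  ultimately show ?thesis
    using True by (simp add: submonoid_cong_def generate_embed_submonoid[OF assms]) blast
qed (auto simp: submonoid_cong_def)

text \<open>
A first isomorphism theorem for quotients by submonoids. The classes of the congruence are the
fibres of \<open>f\<close>, so sending an element of \<open>H\<close> to its fibre is the isomorphism. This direction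
of the map is the easier one to handle, since it needs no choice of representatives; the
other direction follows because \<open>H\<close> is a group.
\<close>

lemma monoid_quotient_iso:
  assumes T: "submonoid T G" and H: "group H"
    and f: "f \<in> hom G H" and surj: "f ` carrier G = carrier H"
    and kernel: "\<And>s s'. s \<in> carrier G \<Longrightarrow> s' \<in> carrier G \<Longrightarrow>
      f s = f s' \<longleftrightarrow> (\<exists>t\<in>T. \<exists>t'\<in>T. s' \<otimes> t' = s \<otimes> t)"
  shows "monoid_quotient G T \<cong> H" and "H \<cong> monoid_quotient G T"
proof -
  define fibre where "fibre z = {s \<in> carrier G. f s = z}" for z
  have fibre: "submonoid_cong G T `` {s} = fibre (f s)" if "s \<in> carrier G" for s
  proof -
    have "(s, s') \<in> submonoid_cong G T \<longleftrightarrow> s' \<in> carrier G \<and> f s' = f s" for s'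
      using that kernel[of s s'] unfolding submonoid_cong_iff[OF T] by metis
    then show ?thesis
      by (simp add: set_eq_iff fibre_def)
  qed
  have "fibre \<in> iso H (monoid_quotient G T)"
  proof (rule isoI)
    show "bij_betw fibre (carrier H) (carrier (monoid_quotient G T))"
    proof (rule bij_betw_imageI)
      show "inj_on fibre (carrier H)"
      proof (rule inj_onI)
        fix y z assume "y \<in> carrier H" "fibre y = fibre z"
        then obtain s where "s \<in> carrier G" "y = f s"
          unfolding surj[symmetric] by blast
        then have "s \<in> fibre z"
          unfolding \<open>fibre y = fibre z\<close>[symmetric] by (simp add: fibre_def)
        then show "y = z"
          by (simp add: fibre_def \<open>y = f s\<close>)
      qed
      show "fibre ` carrier H = carrier (monoid_quotient G T)"
        by (auto simp: monoid_quotient_def quotient_def fibre simp flip: surj)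
    qed
    then show "fibre \<in> hom H (monoid_quotient G T)"
    proof (intro homI)
      fix y z assume yz: "y \<in> carrier H" "z \<in> carrier H"
      have "submonoid_cong G T `` {s \<otimes> s'} = fibre (y \<otimes>\<^bsub>H\<^esub> z)"
        if "s \<in> fibre y" "s' \<in> fibre z" for s s'
        using that by (auto simp: fibre_def fibre hom_mult[OF f])
      moreover have "fibre y \<noteq> {}" "fibre z \<noteq> {}"
        using yz unfolding surj[symmetric] by (auto simp: fibre_def)
      ultimately show "fibre (y \<otimes>\<^bsub>H\<^esub> z) = fibre y \<otimes>\<^bsub>monoid_quotient G T\<^esub> fibre z"
        unfolding monoid_quotient_def by auto
    qed (auto dest: bij_betwE)
  qed
  then show "H \<cong> monoid_quotient G T"
    by (auto simp: is_iso_def)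
  then show "monoid_quotient G T \<cong> H"
    by (rule group.iso_sym[OF H])
qed

text \<open>
When the target has finite exponent \<open>n\<close>, the fibres of a morphism are already determined by its
kernel, although the source has no inverses: the power \<open>n - 1\<close> serves as an inverse modulo
the kernel. Both class groups below are instances of this statement.
\<close>

lemma monoid_quotient_kernel_iso:
  assumes H: "group H" and f: "f \<in> hom G H" and surj: "f ` carrier G = carrier H"
    and n: "n > (0 :: nat)" and exponent: "\<And>z. z \<in> carrier H \<Longrightarrow> z [^]\<^bsub>H\<^esub> n = \<one>\<^bsub>H\<^esub>"
  shows "monoid_quotient G (kernel G H f) \<cong> H" and "H \<cong> monoid_quotient G (kernel G H f)"
proof -
  interpret H: group H
    by fact
  note [simp] = hom_in_carrier[OF f] hom_mult[OF f]
  have "f \<one> \<otimes>\<^bsub>H\<^esub> f \<one> = f \<one>"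
    by (simp flip: hom_mult[OF f])
  then have [simp]: "f \<one> = \<one>\<^bsub>H\<^esub>"
    by (simp only: H.l_cancel_one hom_in_carrier[OF f] one_closed)
  have [simp]: "f (s [^] k) = f s [^]\<^bsub>H\<^esub> k" if "s \<in> carrier G" for s and k :: nat
    using that by (induction k) simp_all
  have T: "submonoid (kernel G H f) G"
    by unfold_locales (auto simp: kernel_def)
  have "f s = f s' \<longleftrightarrow> (\<exists>t\<in>kernel G H f. \<exists>t'\<in>kernel G H f. s' \<otimes> t' = s \<otimes> t)"
    if s: "s \<in> carrier G" "s' \<in> carrier G" for s s'
  proof
    assume eq: "f s = f s'"
    have power: "y \<otimes>\<^bsub>H\<^esub> y [^]\<^bsub>H\<^esub> (n - 1) = \<one>\<^bsub>H\<^esub>" if "y \<in> carrier H" for y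
      using exponent[OF that] H.nat_pow_Suc2[OF that, of "n - 1"] n by simp
    \<comment> \<open>The witnesses are \<open>t = s' s\<^sup>n\<^sup>-\<^sup>1\<close> and \<open>t' = s\<^sup>n\<close>; both products equal \<open>s' s\<^sup>n\<close>.\<close>
    have "s [^] n = s \<otimes> s [^] (n - 1)"
      using nat_pow_Suc2[OF s(1), of "n - 1"] n by simp
    then have "s' \<otimes> s [^] n = s \<otimes> (s' \<otimes> s [^] (n - 1))"
      using s by (simp add: m_lcomm)
    moreover have "s [^] n \<in> kernel G H f" "s' \<otimes> s [^] (n - 1) \<in> kernel G H f"
      using s power[of "f s'"] by (auto simp: kernel_def exponent eq)
    ultimately show "\<exists>t\<in>kernel G H f. \<exists>t'\<in>kernel G H f. s' \<otimes> t' = s \<otimes> t"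
      by blast
  next
    assume "\<exists>t\<in>kernel G H f. \<exists>t'\<in>kernel G H f. s' \<otimes> t' = s \<otimes> t"
    then obtain t t' where t: "t \<in> carrier G" "t' \<in> carrier G" "f t = \<one>\<^bsub>H\<^esub>" "f t' = \<one>\<^bsub>H\<^esub>"
      and "s' \<otimes> t' = s \<otimes> t"
      by (auto simp: kernel_def)
    then have "f (s' \<otimes> t') = f (s \<otimes> t)"
      by simp
    then show "f s = f s'"
      using s t by simp
  qed
  then show "monoid_quotient G (kernel G H f) \<cong> H" "H \<cong> monoid_quotient G (kernel G H f)"
    using monoid_quotient_iso[OF T H f surj] by blast+
qed

end

section \<open>The free monoid and the monoid of solutions of a congruence\<close>

lemma carrier_free_monoid [simp]: "carrier (free_monoid Q) = Q \<rightarrow>\<^sub>E UNIV"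
  by (simp add: free_monoid_def nat_monoid_def)

lemma mult_free_monoid [simp]: "w \<otimes>\<^bsub>free_monoid Q\<^esub> w' = (\<lambda>q\<in>Q. w q + w' q)"
  by (simp add: free_monoid_def nat_monoid_def)

lemma one_free_monoid [simp]: "\<one>\<^bsub>free_monoid Q\<^esub> = (\<lambda>q\<in>Q. 0)"
  by (simp add: free_monoid_def nat_monoid_def)

lemma comm_monoid_cancel_free_monoid: "comm_monoid_cancel (free_monoid Q)"
proof (rule comm_monoid_cancelI)
  show "comm_monoid (free_monoid Q)"
    by (rule comm_monoidI) (auto simp: fun_eq_iff PiE_iff extensional_def)
  show "w = w'" if "w \<otimes>\<^bsub>free_monoid Q\<^esub> v = w' \<otimes>\<^bsub>free_monoid Q\<^esub> v"
    "w \<in> carrier (free_monoid Q)" "w' \<in> carrier (free_monoid Q)" for v w w'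
  proof (rule PiE_ext)
    fix q assume "q \<in> Q"
    then show "w q = w' q"
      using fun_cong[OF that(1), of q] by simp
  qed (use that in auto)
qed

lemma (in comm_monoid_cancel) comm_monoid_cancel_submonoid:
  assumes "submonoid H G"
  shows "comm_monoid_cancel (G\<lparr>carrier := H\<rparr>)"
proof (rule comm_monoid_cancelI)
  show "comm_monoid (G\<lparr>carrier := H\<rparr>)"
    by (rule submonoid_is_comm_monoid[OF assms])
  show "x = y" if "x \<otimes>\<^bsub>G\<lparr>carrier := H\<rparr>\<^esub> z = y \<otimes>\<^bsub>G\<lparr>carrier := H\<rparr>\<^esub> z" "x \<in> carrier (G\<lparr>carrier := H\<rparr>)"
    "y \<in> carrier (G\<lparr>carrier := H\<rparr>)" "z \<in> carrier (G\<lparr>carrier := H\<rparr>)" for x y z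
    using that submonoid.subset[OF assms] by (auto intro: r_cancel)
qed

lemma carrier_cong_monoid: "(x, y) \<in> carrier (cong_monoid a b c) \<longleftrightarrow> c dvd a * x + b * y"
  by (simp add: cong_monoid_def cong_0_iff)

lemma mult_cong_monoid [simp]: "(x, y) \<otimes>\<^bsub>cong_monoid a b c\<^esub> (x', y') = (x + x', y + y')"
  by (simp add: cong_monoid_def DirProd_def nat_monoid_def)

lemma one_cong_monoid [simp]: "\<one>\<^bsub>cong_monoid a b c\<^esub> = (0, 0)"
  by (simp add: cong_monoid_def DirProd_def nat_monoid_def)

lemma monoid_cong_monoid: "monoid (cong_monoid a b c)"
proof (rule monoidI)
  fix p q assume "p \<in> carrier (cong_monoid a b c)" "q \<in> carrier (cong_monoid a b c)"
  then show "p \<otimes>\<^bsub>cong_monoid a b c\<^esub> q \<in> carrier (cong_monoid a b c)"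
  proof (induction p; induction q)
    fix x y x' y' assume "(x, y) \<in> carrier (cong_monoid a b c)" "(x', y') \<in> carrier (cong_monoid a b c)"
    then have "c dvd (a * x + b * y) + (a * x' + b * y')"
      unfolding carrier_cong_monoid by (rule dvd_add)
    then show "(x, y) \<otimes>\<^bsub>cong_monoid a b c\<^esub> (x', y') \<in> carrier (cong_monoid a b c)"
      by (simp add: carrier_cong_monoid algebra_simps)
  qed
qed (auto simp: carrier_cong_monoid)

lemma pow_cong_monoid [simp]:
  "(x, y) [^]\<^bsub>cong_monoid a b c\<^esub> (k :: nat) = (k * x, k * y)"
proof -
  interpret monoid "cong_monoid a b c"
    by (rule monoid_cong_monoid)
  show ?thesis
    by (induction k) (simp_all add: add.commute)
qed

text \<open>
Since congruences may be subtracted, a difference in \<open>\<nat>\<^sup>2\<close> of two solutions is again a solution.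
Hence divisibility in the monoid is the componentwise order.
\<close>

lemma divides_cong_monoid:
  assumes "(x, y) \<in> carrier (cong_monoid a b c)" "(x', y') \<in> carrier (cong_monoid a b c)"
  shows "(x, y) divides\<^bsub>cong_monoid a b c\<^esub> (x', y') \<longleftrightarrow> x \<le> x' \<and> y \<le> y'"
proof
  assume "x \<le> x' \<and> y \<le> y'"
  then obtain s t where st: "x' = x + s" "y' = y + t"
    using le_Suc_ex by blast
  have "c dvd (a * x + b * y) + (a * s + b * t)" "c dvd a * x + b * y"
    using assms by (simp_all add: carrier_cong_monoid st algebra_simps)
  then have "(s, t) \<in> carrier (cong_monoid a b c)"
    by (simp add: carrier_cong_monoid dvd_add_right_iff)
  then show "(x, y) divides\<^bsub>cong_monoid a b c\<^esub> (x', y')"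
    unfolding factor_def by (auto simp: st intro!: bexI[of _ "(s, t)"])
qed (auto simp: factor_def)

lemma pow_in_cong_monoid:
  assumes "(x, y) \<in> carrier (cong_monoid a b c)"
  shows "(k * x, k * y) \<in> carrier (cong_monoid a b c)"
proof -
  have "c dvd k * (a * x + b * y)"
    using assms by (simp add: carrier_cong_monoid)
  then show ?thesis
    by (simp add: carrier_cong_monoid algebra_simps)
qed

section \<open>The function lambda on the two axes\<close>

text \<open>
The ratios \<open>m / k\<close> in question are exactly the nonnegative rationals up to \<open>x / d\<close>, and this bound is
itself attained, at \<open>m = x\<close> and \<open>k = d\<close>.
\<close>

lemma Sup_ratios:
  assumes "d > 0"
  shows "Sup {ennreal (real m / real k) | m k :: nat. k > 0 \<and> m * d \<le> k * x} = ennreal (real x / real d)"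
proof (rule Sup_eqI)
  fix r assume "r \<in> {ennreal (real m / real k) | m k :: nat. k > 0 \<and> m * d \<le> k * x}"
  then obtain m k where mk: "r = ennreal (real m / real k)" "k > 0" "m * d \<le> k * x"
    by blast
  have "real m * real d \<le> real k * real x"
    using mk(3) by (metis of_nat_le_iff of_nat_mult)
  then have "real m / real k \<le> real x / real d"
    using mk(2) assms by (simp add: field_simps)
  then show "r \<le> ennreal (real x / real d)"
    by (simp add: mk(1) ennreal_leI)
next
  fix r assume *: "\<And>s. s \<in> {ennreal (real m / real k) | m k :: nat. k > 0 \<and> m * d \<le> k * x} \<Longrightarrow> s \<le> r"
  show "ennreal (real x / real d) \<le> r"
    by (rule *, rule CollectI, rule exI[of _ x], rule exI[of _ d]) (use assms in simp)
qed

lemma lam_first_axis: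
  assumes "(d, 0) \<in> carrier (cong_monoid a b c)" "d > 0" "(x, y) \<in> carrier (cong_monoid a b c)"
  shows "lam (cong_monoid a b c) (d, 0) (x, y) = ennreal (real x / real d)"
proof -
  have "(d, 0) [^]\<^bsub>cong_monoid a b c\<^esub> m divides\<^bsub>cong_monoid a b c\<^esub> (x, y) [^]\<^bsub>cong_monoid a b c\<^esub> k
      \<longleftrightarrow> m * d \<le> k * x" for m k :: nat
    unfolding pow_cong_monoid
    using pow_in_cong_monoid[OF assms(1), of m] pow_in_cong_monoid[OF assms(3), of k]
    by (simp add: divides_cong_monoid)
  then show ?thesis
    by (simp only: lam_def Sup_ratios[OF assms(2)])
qed

lemma lam_second_axis:
  assumes "(0, d) \<in> carrier (cong_monoid a b c)" "d > 0" "(x, y) \<in> carrier (cong_monoid a b c)"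
  shows "lam (cong_monoid a b c) (0, d) (x, y) = ennreal (real y / real d)"
proof -
  have "(0, d) [^]\<^bsub>cong_monoid a b c\<^esub> m divides\<^bsub>cong_monoid a b c\<^esub> (x, y) [^]\<^bsub>cong_monoid a b c\<^esub> k
      \<longleftrightarrow> m * d \<le> k * y" for m k :: nat
    unfolding pow_cong_monoid
    using pow_in_cong_monoid[OF assms(1), of m] pow_in_cong_monoid[OF assms(3), of k]
    by (simp add: divides_cong_monoid)
  then show ?thesis
    by (simp only: lam_def Sup_ratios[OF assms(2)])
qed

lemma of_nat_times_ratio:
  "of_nat l * ennreal (real u / real n) = ennreal (real (l * u) / real n)"
  by (simp add: ennreal_of_nat_eq_real_of_nat flip: ennreal_mult)

lemma ratio_in_Nats_iff:
  assumes "n > 0"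
  shows "ennreal (real m / real n) \<in> \<nat> \<longleftrightarrow> n dvd m"
proof
  assume "ennreal (real m / real n) \<in> \<nat>"
  then obtain k where "ennreal (real m / real n) = ennreal (real k)"
    by (auto simp: Nats_def ennreal_of_nat_eq_real_of_nat)
  then have "real m = real (n * k)"
    using assms by (simp add: field_simps)
  then show "n dvd m"
    unfolding of_nat_eq_iff by simp
next
  assume "n dvd m"
  then obtain k where "m = n * k"
    by blast
  then show "ennreal (real m / real n) \<in> \<nat>"
    using assms by (simp flip: ennreal_of_nat_eq_real_of_nat)
qed

section \<open>Normal form of the congruence\<close>

text \<open>
With \<open>g = gcd(a, c)\<close> and \<open>h = gcd(b, c)\<close> the data take the shape \<open>a = g\<alpha>\<close>, \<open>b = h\<beta>\<close>, \<open>c = ghn\<close>.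
The hypothesis \<open>gcd(a, b, c) = 1\<close> becomes the coprimality of \<open>g\<close> and \<open>h\<close>, and the other two
coprimality conditions say that \<open>g\<close> and \<open>h\<close> really are the stated greatest common divisors.
\<close>

locale congruence_normal_form =
  fixes g h n \<alpha> \<beta> :: nat
  assumes pos: "g > 0" "h > 0" "n > 0"
    and coprime_gh: "coprime g h"
    and coprime_\<alpha>: "coprime \<alpha> (h * n)"
    and coprime_\<beta>: "coprime \<beta> (g * n)"
begin

abbreviation M :: "(nat \<times> nat) monoid"
  where "M \<equiv> cong_monoid (g * \<alpha>) (h * \<beta>) (g * h * n)"

abbreviation q\<^sub>1 :: "nat \<times> nat" where "q\<^sub>1 \<equiv> (h * n, 0)"
abbreviation q\<^sub>2 :: "nat \<times> nat" where "q\<^sub>2 \<equiv> (0, g * n)"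
abbreviation Q :: "(nat \<times> nat) set" where "Q \<equiv> {q\<^sub>1, q\<^sub>2}"

lemma gcd_coefficients: "gcd (g * \<alpha>) (g * h * n) = g" "gcd (h * \<beta>) (g * h * n) = h"
proof -
  have "gcd (g * \<alpha>) (g * (h * n)) = g" "gcd (h * \<beta>) (h * (g * n)) = h"
    using coprime_\<alpha> coprime_\<beta> by (simp_all add: gcd_mult_left coprime_iff_gcd_eq_1)
  then show "gcd (g * \<alpha>) (g * h * n) = g" "gcd (h * \<beta>) (g * h * n) = h"
    by (simp_all add: ac_simps)
qed

lemma cong_base_eq: "cong_base (g * \<alpha>) (h * \<beta>) (g * h * n) = Q"
  using pos unfolding cong_base_def gcd_coefficients by (simp add: ac_simps)

lemma scaled_in_M_iff: "(h * u, g * v) \<in> carrier M \<longleftrightarrow> n dvd \<alpha> * u + \<beta> * v"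
proof -
  have "g * \<alpha> * (h * u) + h * \<beta> * (g * v) = (g * h) * (\<alpha> * u + \<beta> * v)"
    by (simp add: algebra_simps)
  then show ?thesis
    using pos by (simp add: carrier_cong_monoid)
qed

text \<open>
Reducing the congruence modulo \<open>g\<close> kills its first term and leaves an invertible multiple of \<open>y\<close>,
so \<open>g\<close> divides \<open>y\<close>; symmetrically \<open>h\<close> divides \<open>x\<close>. Dividing the congruence by \<open>gh\<close> then
leaves a congruence modulo \<open>n\<close> with both coefficients invertible.
\<close>

lemma in_M_iff:
  "p \<in> carrier M \<longleftrightarrow> (\<exists>u v. p = (h * u, g * v) \<and> n dvd \<alpha> * u + \<beta> * v)"
proof
  assume "p \<in> carrier M"
  then obtain x y where p: "p = (x, y)" and dvd: "g * h * n dvd g * \<alpha> * x + h * \<beta> * y"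
    by (cases p) (auto simp: carrier_cong_monoid)
  have "g dvd g * \<alpha> * x + h * \<beta> * y" "h dvd h * \<beta> * y + g * \<alpha> * x"
    using dvd by (auto simp: add.commute intro: dvd_trans[OF _ dvd])
  then have "g dvd h * \<beta> * y" "h dvd g * \<alpha> * x"
    by (simp_all add: dvd_add_right_iff mult.assoc)
  moreover have "coprime g (h * \<beta>)" "coprime h (g * \<alpha>)"
    using coprime_gh coprime_\<alpha> coprime_\<beta> by (auto simp: coprime_commute)
  ultimately have "g dvd y" "h dvd x"
    using coprime_dvd_mult_right_iff by blast+
  then obtain u v where "x = h * u" "y = g * v"
    by (auto elim!: dvdE)
  then show "\<exists>u v. p = (h * u, g * v) \<and> n dvd \<alpha> * u + \<beta> * v"
    using \<open>p \<in> carrier M\<close> p scaled_in_M_iff by auto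
qed (auto simp: scaled_in_M_iff)

text \<open>
As \<open>\<beta>\<close> is invertible modulo \<open>n\<close>, every \<open>u\<close> is the first coordinate of a solution. The case
\<open>u = 1\<close> forces \<open>\<ell>(q\<^sub>1)\<close> to be a multiple of \<open>n\<close>, and the general case makes the inner class group all of
\<open>\<int>/n\<int>\<close>.
\<close>

lemma completion_second: "\<exists>v. n dvd \<alpha> * u + \<beta> * v"
proof -
  obtain w where "[\<beta> * w = 1] (mod n)"
    using coprime_\<beta> cong_solve_coprime_nat[of \<beta> n] by auto
  \<comment> \<open>The factor \<open>n - 1\<close> plays the role of \<open>-1\<close>: with \<open>w\<close> inverse to \<open>\<beta>\<close>, the solution is \<open>v = - w \<alpha> u\<close>.\<close>
  then have "[\<alpha> * u + (\<beta> * w) * ((n - 1) * (\<alpha> * u)) = \<alpha> * u + 1 * ((n - 1) * (\<alpha> * u))] (mod n)"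
    by (intro cong_add cong_mult cong_refl)
  moreover have "\<alpha> * u + 1 * ((n - 1) * (\<alpha> * u)) = n * (\<alpha> * u)"
    using pos by (simp add: mult_eq_if[of n])
  ultimately have "n dvd \<alpha> * u + \<beta> * (w * ((n - 1) * (\<alpha> * u)))"
    by (simp add: cong_dvd_iff mult.assoc)
  then show ?thesis
    by blast
qed

lemma completion_first: "\<exists>u. n dvd \<alpha> * u + \<beta> * v"
proof -
  interpret flip: congruence_normal_form h g n \<beta> \<alpha>
    using pos coprime_gh coprime_\<alpha> coprime_\<beta> by unfold_locales (auto simp: coprime_commute)
  show ?thesis
    using flip.completion_second[of v] by (simp add: add.commute)
qed

lemma base_in_M: "q\<^sub>1 \<in> carrier M" "q\<^sub>2 \<in> carrier M"
  by (auto simp: carrier_cong_monoid)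

lemma lam_base:
  assumes "(h * u, g * v) \<in> carrier M"
  shows "lam M q\<^sub>1 (h * u, g * v) = ennreal (real u / real n)"
    and "lam M q\<^sub>2 (h * u, g * v) = ennreal (real v / real n)"
  using lam_first_axis[OF base_in_M(1) _ assms] lam_second_axis[OF base_in_M(2) _ assms] pos
  by simp_all

section \<open>The embedding into the free monoid\<close>

text \<open>
The values of \<open>\<lambda>(q, _)\<close> on the monoid are the fractions \<open>u / n\<close> with \<open>u\<close> a scaled coordinate, and
\<open>u = 1\<close> occurs. So the multipliers that clear all denominators are the multiples of \<open>n\<close>.
\<close>

lemma ell_base: "ell M q\<^sub>1 = n" "ell M q\<^sub>2 = n"
proof -
  have least: "(LEAST l. l > 0 \<and> n dvd l) = n"
    using pos by (intro Least_equality) (auto dest: dvd_imp_le)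
  obtain v where v: "(h * 1, g * v) \<in> carrier M"
    using completion_second[of 1] scaled_in_M_iff by blast
  obtain u where u: "(h * u, g * 1) \<in> carrier M"
    using completion_first[of 1] scaled_in_M_iff by blast
  have 1: "(\<forall>p\<in>carrier M. of_nat l * lam M q\<^sub>1 p \<in> \<nat>) \<longleftrightarrow> n dvd l" for l
  proof
    assume "\<forall>p\<in>carrier M. of_nat l * lam M q\<^sub>1 p \<in> \<nat>"
    then have "of_nat l * lam M q\<^sub>1 (h * 1, g * v) \<in> \<nat>"
      using v by blast
    then show "n dvd l"
      unfolding lam_base(1)[OF v] of_nat_times_ratio ratio_in_Nats_iff[OF pos(3)] by simp
  next
    assume "n dvd l"
    then have "of_nat l * lam M q\<^sub>1 (h * u, g * v) \<in> \<nat>" if "(h * u, g * v) \<in> carrier M" for u v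
      unfolding lam_base(1)[OF that] of_nat_times_ratio ratio_in_Nats_iff[OF pos(3)] by simp
    then show "\<forall>p\<in>carrier M. of_nat l * lam M q\<^sub>1 p \<in> \<nat>"
      using in_M_iff by metis
  qed
  have 2: "(\<forall>p\<in>carrier M. of_nat l * lam M q\<^sub>2 p \<in> \<nat>) \<longleftrightarrow> n dvd l" for l
  proof
    assume "\<forall>p\<in>carrier M. of_nat l * lam M q\<^sub>2 p \<in> \<nat>"
    then have "of_nat l * lam M q\<^sub>2 (h * u, g * 1) \<in> \<nat>"
      using u by blast
    then show "n dvd l"
      unfolding lam_base(2)[OF u] of_nat_times_ratio ratio_in_Nats_iff[OF pos(3)] by simp
  next
    assume "n dvd l"
    then have "of_nat l * lam M q\<^sub>2 (h * u, g * v) \<in> \<nat>" if "(h * u, g * v) \<in> carrier M" for u v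
      unfolding lam_base(2)[OF that] of_nat_times_ratio ratio_in_Nats_iff[OF pos(3)] by simp
    then show "\<forall>p\<in>carrier M. of_nat l * lam M q\<^sub>2 p \<in> \<nat>"
      using in_M_iff by metis
  qed
  show "ell M q\<^sub>1 = n" "ell M q\<^sub>2 = n"
    unfolding ell_def 1 2 by (rule least)+
qed

definition vec :: "nat \<Rightarrow> nat \<Rightarrow> nat \<times> nat \<Rightarrow> nat"
  where "vec u v = (\<lambda>q\<in>Q. if q = q\<^sub>1 then u else v)"

lemma base_distinct: "q\<^sub>1 = q\<^sub>1 \<longleftrightarrow> True" "q\<^sub>2 = q\<^sub>1 \<longleftrightarrow> False"
  using pos by auto

lemma vec_nth [simp]: "vec u v q\<^sub>1 = u" "vec u v q\<^sub>2 = v"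
  using pos by (auto simp: vec_def)

lemma vec_eqI:
  assumes "w \<in> Q \<rightarrow>\<^sub>E UNIV"
  shows "w = vec (w q\<^sub>1) (w q\<^sub>2)"
  using assms pos by (intro PiE_ext[OF assms]) (auto simp: vec_def)

lemma vec_in_carrier: "vec u v \<in> carrier (free_monoid Q)"
  unfolding vec_def carrier_free_monoid restrict_PiE_iff by simp

lemma carrier_free_monoid_base: "carrier (free_monoid Q) = {vec u v | u v. True}"
proof (intro equalityI subsetI)
  fix w assume "w \<in> carrier (free_monoid Q)"
  then have "w = vec (w q\<^sub>1) (w q\<^sub>2)"
    unfolding carrier_free_monoid by (rule vec_eqI)
  then show "w \<in> {vec u v | u v. True}"
    by blast
qed (use vec_in_carrier in blast)

lemma mult_vec: "vec u v \<otimes>\<^bsub>free_monoid Q\<^esub> vec u' v' = vec (u + u') (v + v')"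
  by (auto simp: vec_def fun_eq_iff)

lemma one_vec: "\<one>\<^bsub>free_monoid Q\<^esub> = vec 0 0"
  by (auto simp: vec_def fun_eq_iff)

text \<open>
Thus \<open>\<phi>\<close> just divides the coordinates by \<open>h\<close> and \<open>g\<close>, because \<open>\<ell>(q) = n\<close> cancels the
denominator of \<open>\<lambda>(q, _)\<close>.
\<close>

lemma phi_scaled:
  assumes "(h * u, g * v) \<in> carrier M"
  shows "phi M Q (h * u, g * v) = vec u v"
proof -
  have "of_nat n * ennreal (real m / real n) = of_nat m" for m :: nat
    unfolding of_nat_times_ratio using pos by (simp add: ennreal_of_nat_eq_real_of_nat)
  then have "(THE k. of_nat k = of_nat n * ennreal (real m / real n)) = m" for m :: nat
    by simp
  then have "(THE k. of_nat k = of_nat (ell M q) * lam M q (h * u, g * v)) = (if q = q\<^sub>1 then u else v)"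
    if "q \<in> Q" for q
    using that by (elim insertE emptyE) (simp_all only: ell_base lam_base[OF assms] base_distinct if_True if_False)
  then show ?thesis
    unfolding phi_def vec_def by (rule restrict_ext)
qed

lemma phi_M: "phi M Q ` carrier M = {vec u v | u v. n dvd \<alpha> * u + \<beta> * v}"
proof (intro equalityI subsetI)
  fix w assume "w \<in> phi M Q ` carrier M"
  then obtain p where "w = phi M Q p" "p \<in> carrier M"
    by blast
  moreover obtain u v where "p = (h * u, g * v)" "n dvd \<alpha> * u + \<beta> * v"
    using \<open>p \<in> carrier M\<close> in_M_iff by blast
  ultimately have "w = phi M Q (h * u, g * v)" "n dvd \<alpha> * u + \<beta> * v"
    by simp_all
  then show "w \<in> {vec u v | u v. n dvd \<alpha> * u + \<beta> * v}"
    using phi_scaled scaled_in_M_iff by blast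
next
  fix w assume "w \<in> {vec u v | u v. n dvd \<alpha> * u + \<beta> * v}"
  then obtain u v where "w = vec u v" "(h * u, g * v) \<in> carrier M"
    unfolding scaled_in_M_iff by blast
  then show "w \<in> phi M Q ` carrier M"
    by (metis phi_scaled image_eqI)
qed

lemma hull_base: "(\<lambda>H. submonoid H M) hull Q = {(h * (n * i), g * (n * j)) | i j. True}"
    (is "_ = ?F")
proof (rule hull_unique)
  show "Q \<subseteq> ?F"
    by (auto intro: exI[of _ 0] exI[of _ 1])
  show "submonoid ?F M"
  proof
    show "?F \<subseteq> carrier M"
      by (auto simp: scaled_in_M_iff)
    show "p \<otimes>\<^bsub>M\<^esub> q \<in> ?F" if "p \<in> ?F" "q \<in> ?F" for p q
      using that by (auto simp flip: distrib_left)
  qed auto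
  fix H assume "Q \<subseteq> H" "submonoid H M"
  interpret submonoid H M
    by fact
  have multiple: "(i * x, i * y) \<in> H" if "(x, y) \<in> H" for i x y :: nat
  proof (induction i)
    case (Suc i)
    then show ?case
      using m_closed[OF that Suc] by simp
  qed (use one_closed in simp)
  show "?F \<subseteq> H"
  proof clarify
    fix i j
    have "(i * (h * n), i * 0) \<otimes>\<^bsub>M\<^esub> (j * 0, j * (g * n)) \<in> H"
      using \<open>Q \<subseteq> H\<close> by (intro m_closed multiple) auto
    then show "(h * (n * i), g * (n * j)) \<in> H"
      by (simp add: ac_simps)
  qed
qed

lemma phi_hull_base: "phi M Q ` ((\<lambda>H. submonoid H M) hull Q) = {vec (n * i) (n * j) | i j. True}"
proof -
  have "phi M Q (h * (n * i), g * (n * j)) = vec (n * i) (n * j)" for i j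
    by (rule phi_scaled) (simp add: scaled_in_M_iff)
  note phi = this
  show ?thesis
    unfolding hull_base
  proof (intro equalityI subsetI)
    fix w assume "w \<in> phi M Q ` {(h * (n * i), g * (n * j)) | i j. True}"
    then obtain i j where "w = phi M Q (h * (n * i), g * (n * j))"
      by blast
    then show "w \<in> {vec (n * i) (n * j) | i j. True}"
      unfolding phi by blast
  next
    fix w assume "w \<in> {vec (n * i) (n * j) | i j. True}"
    then obtain i j where "w = phi M Q (h * (n * i), g * (n * j))"
      unfolding phi by blast
    then show "w \<in> phi M Q ` {(h * (n * i), g * (n * j)) | i j. True}"
      by blast
  qed
qed

lemma submonoid_phi_M: "submonoid {vec u v | u v. n dvd \<alpha> * u + \<beta> * v} (free_monoid Q)"
  (is "submonoid ?\<Phi> _")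
proof
  show "?\<Phi> \<subseteq> carrier (free_monoid Q)"
    using vec_in_carrier by blast
  show "w \<otimes>\<^bsub>free_monoid Q\<^esub> w' \<in> ?\<Phi>" if ww': "w \<in> ?\<Phi>" "w' \<in> ?\<Phi>" for w w'
  proof -
    obtain u v u' v' where w: "w = vec u v" "w' = vec u' v'"
      and dvd: "n dvd \<alpha> * u + \<beta> * v" "n dvd \<alpha> * u' + \<beta> * v'"
      using ww' by blast
    have "n dvd \<alpha> * (u + u') + \<beta> * (v + v')"
      using dvd_add[OF dvd] by (simp add: algebra_simps)
    then show ?thesis
      unfolding w mult_vec by blast
  qed
  show "\<one>\<^bsub>free_monoid Q\<^esub> \<in> ?\<Phi>"
    unfolding one_vec using dvd_0_right by (intro CollectI exI[of _ 0]) simp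
qed

section \<open>The class groups\<close>

text \<open>
The image of \<open>\<phi>\<close> is the kernel of \<open>(u, v) \<mapsto> \<alpha>u + \<beta>v mod n\<close> on \<open>\<nat>\<^sup>Q\<close>, which is onto because
\<open>\<alpha>\<close> is invertible modulo \<open>n\<close>.
\<close>

lemma outer_class_group_iso:
  "outer_class_group M Q \<cong> integer_mod_group n" "integer_mod_group n \<cong> outer_class_group M Q"
proof -
  interpret comm_monoid_cancel "free_monoid Q"
    by (rule comm_monoid_cancel_free_monoid)
  define f where "f w = int ((\<alpha> * w q\<^sub>1 + \<beta> * w q\<^sub>2) mod n)" for w
  have f_vec: "f (vec u v) = int ((\<alpha> * u + \<beta> * v) mod n)" for u v
    by (simp only: f_def vec_nth)
  have in_Zn: "f w \<in> carrier (integer_mod_group n)" for w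
    using pos by (simp add: f_def carrier_integer_mod_group)
  have f_hom: "f \<in> hom (free_monoid Q) (integer_mod_group n)"
  proof (rule homI)
    fix w w' assume "w \<in> carrier (free_monoid Q)" "w' \<in> carrier (free_monoid Q)"
    then obtain u v u' v' where "w = vec u v" "w' = vec u' v'"
      unfolding carrier_free_monoid_base by blast
    moreover have "(\<alpha> * (u + u') + \<beta> * (v + v')) mod n
        = ((\<alpha> * u + \<beta> * v) mod n + (\<alpha> * u' + \<beta> * v') mod n) mod n"
      unfolding mod_add_eq by (simp add: algebra_simps)
    ultimately show "f (w \<otimes>\<^bsub>free_monoid Q\<^esub> w') = f w \<otimes>\<^bsub>integer_mod_group n\<^esub> f w'"
      by (simp only: mult_vec f_vec mult_integer_mod_group of_nat_mod of_nat_add)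
  qed (rule in_Zn)
  have surj: "f ` carrier (free_monoid Q) = carrier (integer_mod_group n)"
  proof
    show "f ` carrier (free_monoid Q) \<subseteq> carrier (integer_mod_group n)"
      using in_Zn by blast
    show "carrier (integer_mod_group n) \<subseteq> f ` carrier (free_monoid Q)"
    proof
      fix z assume "z \<in> carrier (integer_mod_group n)"
      then have z: "0 \<le> z" "z < int n"
        using pos by (auto simp: carrier_integer_mod_group)
      obtain w where "[\<alpha> * w = 1] (mod n)"
        using coprime_\<alpha> cong_solve_coprime_nat[of \<alpha> n] by auto
      then have "[\<alpha> * w * nat z = 1 * nat z] (mod n)"
        by (intro cong_mult cong_refl)
      then have "\<alpha> * (w * nat z) mod n = nat z"
        using z by (simp add: cong_def mult.assoc)
      then have "z = f (vec (w * nat z) 0)"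
        using z by (simp add: f_vec)
      then show "z \<in> f ` carrier (free_monoid Q)"
        unfolding carrier_free_monoid_base by blast
    qed
  qed
  have "kernel (free_monoid Q) (integer_mod_group n) f = phi M Q ` carrier M"
  proof -
    have "f (vec u v) = 0 \<longleftrightarrow> n dvd \<alpha> * u + \<beta> * v" for u v
      unfolding f_vec by (simp add: mod_eq_0_iff_dvd del: of_nat_mod)
    then show ?thesis
      unfolding kernel_def phi_M carrier_free_monoid_base one_integer_mod_group by blast
  qed
  then show "outer_class_group M Q \<cong> integer_mod_group n"
      "integer_mod_group n \<cong> outer_class_group M Q"
    using monoid_quotient_kernel_iso[OF group_integer_mod_group f_hom surj pos(3)]
    by (simp_all add: outer_class_group_def)
qed

text \<open>
On the image of \<open>\<phi>\<close> the residue of \<open>u\<close> modulo \<open>n\<close> determines that of \<open>v\<close>, as \<open>\<beta>\<close> is invertible.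
So the kernel of \<open>(u, v) \<mapsto> u mod n\<close> consists of the pairs with both coordinates divisible by \<open>n\<close>,
and these are the images of the elements generated by \<open>Q\<close>.
\<close>

lemma inner_class_group_iso: "inner_class_group M Q \<cong> integer_mod_group n"
proof -
  define \<Phi> where "\<Phi> = free_monoid Q\<lparr>carrier := phi M Q ` carrier M\<rparr>"
  interpret comm_monoid_cancel \<Phi>
    unfolding \<Phi>_def phi_M
    by (rule comm_monoid_cancel.comm_monoid_cancel_submonoid[OF comm_monoid_cancel_free_monoid submonoid_phi_M])
  have carrier_\<Phi>: "carrier \<Phi> = {vec u v | u v. n dvd \<alpha> * u + \<beta> * v}"
    by (simp add: \<Phi>_def phi_M)
  define f where "f w = int (w q\<^sub>1 mod n)" for w :: "nat \<times> nat \<Rightarrow> nat"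
  have f_vec: "f (vec u v) = int (u mod n)" for u v
    by (simp only: f_def vec_nth)
  have in_Zn: "f w \<in> carrier (integer_mod_group n)" for w
    using pos by (simp add: f_def carrier_integer_mod_group)
  have f_hom: "f \<in> hom \<Phi> (integer_mod_group n)"
  proof (rule homI)
    fix w w' assume "w \<in> carrier \<Phi>" "w' \<in> carrier \<Phi>"
    then obtain u v u' v' where "w = vec u v" "w' = vec u' v'"
      unfolding carrier_\<Phi> by auto
    then have "w \<otimes>\<^bsub>\<Phi>\<^esub> w' = vec (u + u') (v + v')" "w = vec u v" "w' = vec u' v'"
      by (simp_all add: \<Phi>_def mult_vec del: mult_free_monoid)
    then show "f (w \<otimes>\<^bsub>\<Phi>\<^esub> w') = f w \<otimes>\<^bsub>integer_mod_group n\<^esub> f w'"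
      by (simp add: f_vec mod_simps zmod_int)
  qed (rule in_Zn)
  have surj: "f ` carrier \<Phi> = carrier (integer_mod_group n)"
  proof
    show "f ` carrier \<Phi> \<subseteq> carrier (integer_mod_group n)"
      using in_Zn by blast
    show "carrier (integer_mod_group n) \<subseteq> f ` carrier \<Phi>"
    proof
      fix z assume "z \<in> carrier (integer_mod_group n)"
      then have z: "0 \<le> z" "z < int n"
        using pos by (auto simp: carrier_integer_mod_group)
      obtain v where "n dvd \<alpha> * nat z + \<beta> * v"
        using completion_second by blast
      then have "vec (nat z) v \<in> carrier \<Phi>"
        unfolding carrier_\<Phi> by blast
      moreover have "z = f (vec (nat z) v)"
        using z by (simp add: f_vec)
      ultimately show "z \<in> f ` carrier \<Phi>"
        by blast
    qed
  qed
  have "kernel \<Phi> (integer_mod_group n) f = {vec (n * i) (n * j) | i j. True}"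
  proof
    show "kernel \<Phi> (integer_mod_group n) f \<subseteq> {vec (n * i) (n * j) | i j. True}"
    proof
      fix w assume "w \<in> kernel \<Phi> (integer_mod_group n) f"
      then obtain u v where w: "w = vec u v" and dvd: "n dvd \<alpha> * u + \<beta> * v" and "f w = 0"
        by (auto simp: kernel_def carrier_\<Phi>)
      then have "n dvd u"
        by (simp add: f_vec mod_eq_0_iff_dvd del: of_nat_mod)
      then have "n dvd \<beta> * v"
        using dvd by (simp add: dvd_add_right_iff)
      then have "n dvd v"
        using coprime_\<beta> by (simp add: coprime_dvd_mult_right_iff coprime_commute)
      then show "w \<in> {vec (n * i) (n * j) | i j. True}"
        using \<open>n dvd u\<close> by (auto simp: w elim!: dvdE)
    qed
    show "{vec (n * i) (n * j) | i j. True} \<subseteq> kernel \<Phi> (integer_mod_group n) f"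
    proof clarify
      fix i j
      have "n dvd \<alpha> * (n * i) + \<beta> * (n * j)"
        by simp
      then show "vec (n * i) (n * j) \<in> kernel \<Phi> (integer_mod_group n) f"
        unfolding kernel_def carrier_\<Phi> by (intro CollectI conjI exI) (auto simp: f_vec)
    qed
  qed
  then have "kernel \<Phi> (integer_mod_group n) f = phi M Q ` ((\<lambda>H. submonoid H M) hull Q)"
    by (simp only: phi_hull_base)
  then show ?thesis
    using monoid_quotient_kernel_iso(1)[OF group_integer_mod_group f_hom surj pos(3)]
    by (simp add: inner_class_group_def flip: \<Phi>_def)
qed

end

theorem theorem4:
  fixes a b c :: nat
  assumes "c > 0"
    and "a \<in> {1..c - 1}" and "b \<in> {1..c - 1}"
    and "gcd a (gcd b c) = 1"
  shows "inner_class_group (cong_monoid a b c) (cong_base a b c) \<cong>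
           outer_class_group (cong_monoid a b c) (cong_base a b c) \<and>
         outer_class_group (cong_monoid a b c) (cong_base a b c) \<cong>
           integer_mod_group (c div (gcd a c * gcd b c))"
proof -
  define g h where "g = gcd a c" and "h = gcd b c"
  have pos: "g > 0" "h > 0"
    using assms(1) by (simp_all add: g_def h_def)
  have coprime_gh: "coprime g h"
    using assms(4) unfolding g_def h_def coprime_iff_gcd_eq_1
    by (metis gcd.assoc gcd.commute gcd_1_nat gcd.left_commute)
  have "g * h dvd c"
    using coprime_gh by (intro divides_mult) (simp_all add: g_def h_def)
  then obtain n where c: "c = g * h * n"
    by blast
  obtain \<alpha> where a: "a = g * \<alpha>"
    using gcd_dvd1[of a c] unfolding g_def by blast
  obtain \<beta> where b: "b = h * \<beta>"
    using gcd_dvd1[of b c] unfolding h_def by blast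
  have "gcd (g * \<alpha>) (g * (h * n)) = g * 1" "gcd (h * \<beta>) (h * (g * n)) = h * 1"
    using g_def h_def unfolding a b c by (simp_all add: ac_simps)
  then have "coprime \<alpha> (h * n)" "coprime \<beta> (g * n)"
    using pos unfolding gcd_mult_distrib_nat[symmetric] coprime_iff_gcd_eq_1 by simp_all
  moreover have "n > 0"
    using assms(1) unfolding c by simp
  ultimately interpret congruence_normal_form g h n \<alpha> \<beta>
    using pos coprime_gh by unfold_locales
  have base: "cong_base a b c = Q"
    unfolding a b c by (rule cong_base_eq)
  have order: "c div (gcd a c * gcd b c) = n"
  proof -
    have "c div (g * h) = n"
      using pos by (simp add: c)
    then show ?thesis
      unfolding g_def h_def .
  qed
  have "inner_class_group M Q \<cong> outer_class_group M Q"
    by (rule iso_trans[OF inner_class_group_iso outer_class_group_iso(2)])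
  then show ?thesis
    using outer_class_group_iso(1) unfolding base order unfolding a b c by simp
qed

end
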